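(* Let $d\ge1$. Assume that $0\le u_0\in\mathcal{M}_{\rm loc}(\mathbb{R}^d)$ and that its optimal index $\varepsilon_0=\varepsilon_0(u_0)$ satisfies $0<\varepsilon_0<\infty$. Set $T:=\frac1{4\varepsilon_0}$ and $$u(x,t)=\frac{1}{(4\pi t)^{d/2}}\int_{\mathbb{R}^d}e^{-|x-y|^2/4t}\,\mathrm{d}u_0(y).$$ Then $u$ is not defined (i.e. is not finite) at any point $x\in\mathbb{R}^d$ for any time $t>T$. Furthermore, for each $x\in\mathbb{R}^d$, as $t\to T$ (from below), $$u(x,t)\to\begin{cases}u(x,T)<\infty&\text{if }\tau_{-x}u_0\in\mathcal{M}_{\varepsilon_0}(\mathbb{R}^d),\\ \infty&\text{if }\tau_{-x}u_0\notin\mathcal{M}_{\varepsilon_0}(\mathbb{R}^d).\end{cases}$$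
   Context: $\mathcal{M}_{\rm loc}(\mathbb{R}^d)$ is the set of (signed) Radon measures on $\mathbb{R}^d$, identified with the dual of $C_c(\mathbb{R}^d)$; $|\mu|=\mu^++\mu^-$ is the total variation measure. For $\varepsilon>0$, $\mathcal{M}_\varepsilon(\mathbb{R}^d)=\{\mu\in\mathcal{M}_{\rm loc}(\mathbb{R}^d):\int e^{-\varepsilon|x|^2}\,\mathrm{d}|\mu|(x)<\infty\}$; these spaces increase with $\varepsilon$. The optimal index of $\mu$ is $\varepsilon_0(\mu)=\inf\{\varepsilon>0:\mu\in\mathcal{M}_\varepsilon(\mathbb{R}^d)\}\in[0,\infty]$. For $y\in\mathbb{R}^d$ the translate $\tau_y\mu$ is defined by $\int\varphi(x)\,\mathrm{d}\tau_y\mu(x)=\int\varphi(z+y)\,\mathrm{d}\mu(z)$ for all $\varphi\in C_c(\mathbb{R}^d)$. For non-negative $u_0$ the integral defining $u(x,t)$ takes values in $[0,\infty]$. *)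

theory Defs
  imports "HOL-Analysis.Analysis"
begin

text \<open>
  The non-negative cone of the space of signed Radon measures: on a Euclidean space the positive
  functionals on the continuous functions of compact support correspond to the Borel measures that
  are finite on compact sets (regularity is then automatic). For such a measure the total
  variation measure is the measure itself.
\<close>

definition Mloc_nonneg :: "'a::euclidean_space measure set" where
  "Mloc_nonneg = {\<mu>. sets \<mu> = sets borel \<and> (\<forall>K. compact K \<longrightarrow> emeasure \<mu> K < \<infinity>)}"

definition Meps_nonneg :: "real \<Rightarrow> 'a::euclidean_space measure set" where
  "Meps_nonneg \<epsilon> =
     {\<mu> \<in> Mloc_nonneg. (\<integral>\<^sup>+ x. ennreal (exp (- \<epsilon> * (norm x)\<^sup>2)) \<partial>\<mu>) < \<infinity>}"

text \<open>The infimum is taken in \<open>[0, \<infinity>]\<close>, so that the infimum of the empty set is \<open>\<infinity>\<close>.\<close>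

definition optimal_index :: "'a::euclidean_space measure \<Rightarrow> ennreal" where
  "optimal_index \<mu> = Inf (ennreal ` {\<epsilon>. 0 < \<epsilon> \<and> \<mu> \<in> Meps_nonneg \<epsilon>})"

definition translate :: "'a::euclidean_space \<Rightarrow> 'a measure \<Rightarrow> 'a measure" where
  "translate y \<mu> = distr \<mu> borel (\<lambda>z. z + y)"

text \<open>The translate is usually specified by testing against continuous functions of compact
  support; the push-forward satisfies that identity.\<close>

lemma integral_translate:
  fixes \<phi> :: "'a::euclidean_space \<Rightarrow> real"
  assumes "\<mu> \<in> Mloc_nonneg" and "continuous_on UNIV \<phi>"
  shows "(\<integral>x. \<phi> x \<partial>(translate y \<mu>)) = (\<integral>z. \<phi> (z + y) \<partial>\<mu>)"
proof -
  have s: "sets \<mu> = sets borel"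
    using assms(1) by (simp add: Mloc_nonneg_def)
  have m: "(\<lambda>z. z + y) \<in> measurable \<mu> borel"
    unfolding measurable_cong_sets[OF s refl] by measurable
  have "\<phi> \<in> borel_measurable borel"
    using assms(2) by (rule borel_measurable_continuous_onI)
  then show ?thesis
    unfolding translate_def by (intro integral_distr m)
qed

definition heat_solution :: "'a::euclidean_space measure \<Rightarrow> 'a \<Rightarrow> real \<Rightarrow> ennreal" where
  "heat_solution \<mu> x t =
     ennreal (1 / (4 * pi * t) powr (real DIM('a) / 2)) *
     (\<integral>\<^sup>+ y. ennreal (exp (- (norm (x - y))\<^sup>2 / (4 * t))) \<partial>\<mu>)"

end

theory Submission
  imports Defs
begin

text \<open>
  Apart from its scalar prefactor, the solution at \<open>(x, t)\<close> is the integral of the Gaussian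
  \<open>exp (- a |x - y|\<^sup>2)\<close> with \<open>a = 1 / (4 t)\<close>, and \<open>t = T\<close> corresponds to \<open>a = \<epsilon>0\<close>.

  Beyond \<open>T\<close> the exponent \<open>a\<close> is smaller than \<open>\<epsilon>0\<close>. Moving the centre of a Gaussian from \<open>x\<close> to the
  origin costs only a constant factor and an arbitrarily small increase of the exponent
  (\<open>gaussian_recentre\<close>, a weighted form of \<open>|x - y|\<^sup>2 \<le> 2 |x|\<^sup>2 + 2 |y|\<^sup>2\<close>). A finite value of the
  solution would therefore place the measure in \<open>Meps_nonneg \<delta>\<close> for some \<open>\<delta> < \<epsilon>0\<close>, against the
  choice of \<open>\<epsilon>0\<close> as an infimum.

  Below \<open>T\<close> the Gaussians increase pointwise with \<open>t\<close>, so monotone convergence gives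
  \<open>u(x, t) \<rightarrow> u(x, T)\<close> in \<open>[0, \<infinity>]\<close>, whether or not the limit is finite. The dichotomy is then only
  the question whether \<open>u(x, T)\<close> is finite, and after the substitution \<open>z = y - x\<close> this is
  membership of the translated measure in \<open>Meps_nonneg \<epsilon>0\<close>.
\<close>

lemma Mloc_nonneg_measurable:
  assumes "\<mu> \<in> Mloc_nonneg" and "f \<in> borel_measurable borel"
  shows "f \<in> borel_measurable \<mu>"
  using assms by (simp add: Mloc_nonneg_def cong: measurable_cong_sets)

text \<open>
  The constant is the sharp one: with \<open>p = |x|\<close> and \<open>q = |y|\<close> the two sides of
  \<open>a (p + q)\<^sup>2 \<le> \<delta> q\<^sup>2 + (a \<delta> / (\<delta> - a)) p\<^sup>2\<close> differ by
  \<open>\<delta> - a\<close> times the square of \<open>q - (a / (\<delta> - a)) p\<close>.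
\<close>

lemma gaussian_recentre:
  fixes x y :: "'a::real_normed_vector" and a \<delta> :: real
  assumes "0 < a" and "a < \<delta>"
  shows "exp (- \<delta> * (norm y)\<^sup>2)
    \<le> exp (a * \<delta> / (\<delta> - a) * (norm x)\<^sup>2) * exp (- a * (norm (x - y))\<^sup>2)"
proof -
  have "(norm (x - y))\<^sup>2 \<le> (norm x + norm y)\<^sup>2"
    by (intro power_mono norm_triangle_ineq4) simp
  then have "a * (norm (x - y))\<^sup>2 \<le> a * (norm x + norm y)\<^sup>2"
    using assms by simp
  also have "\<dots> = \<delta> * (norm y)\<^sup>2 + a * \<delta> / (\<delta> - a) * (norm x)\<^sup>2
      - (\<delta> - a) * (norm y - a / (\<delta> - a) * norm x)\<^sup>2"
  proof -
    have a: "a * \<delta> / (\<delta> - a) = a + a * (a / (\<delta> - a))"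
      and b: "(\<delta> - a) * (a / (\<delta> - a)) = a"
      using assms by (simp_all add: field_simps)
    define c where "c = a / (\<delta> - a)"
    have "(\<delta> - a) * (norm y - c * norm x)\<^sup>2
        = (\<delta> - a) * (norm y)\<^sup>2 - 2 * ((\<delta> - a) * c) * norm x * norm y
          + ((\<delta> - a) * c) * c * (norm x)\<^sup>2"
      by (simp add: power2_eq_square algebra_simps)
    also have "\<dots> = (\<delta> - a) * (norm y)\<^sup>2 - 2 * a * norm x * norm y + a * c * (norm x)\<^sup>2"
      using b by (simp add: c_def)
    finally show ?thesis
      unfolding a c_def[symmetric] by (simp add: power2_eq_square algebra_simps)
  qed
  also have "\<dots> \<le> \<delta> * (norm y)\<^sup>2 + a * \<delta> / (\<delta> - a) * (norm x)\<^sup>2"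
    using assms by simp
  finally show ?thesis
    unfolding exp_add[symmetric] by simp
qed

lemma Meps_nonneg_if_gaussian_integral_finite:
  fixes x :: "'a::euclidean_space" and a \<delta> :: real
  assumes \<mu>: "\<mu> \<in> Mloc_nonneg" and a: "0 < a" "a < \<delta>"
    and fin: "(\<integral>\<^sup>+ y. ennreal (exp (- a * (norm (x - y))\<^sup>2)) \<partial>\<mu>) < \<infinity>"
  shows "\<mu> \<in> Meps_nonneg \<delta>"
proof -
  define C where "C = exp (a * \<delta> / (\<delta> - a) * (norm x)\<^sup>2)"
  have "(\<integral>\<^sup>+ y. ennreal (exp (- \<delta> * (norm y)\<^sup>2)) \<partial>\<mu>)
      \<le> (\<integral>\<^sup>+ y. ennreal C * ennreal (exp (- a * (norm (x - y))\<^sup>2)) \<partial>\<mu>)"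
    using gaussian_recentre[OF a] unfolding C_def
    by (intro nn_integral_mono) (simp add: ennreal_mult[symmetric])
  also have "\<dots> = ennreal C * (\<integral>\<^sup>+ y. ennreal (exp (- a * (norm (x - y))\<^sup>2)) \<partial>\<mu>)"
    by (intro nn_integral_cmult Mloc_nonneg_measurable[OF \<mu>]) measurable
  also have "\<dots> < \<infinity>"
    using fin by (simp add: ennreal_mult_less_top)
  finally show ?thesis
    using \<mu> by (simp add: Meps_nonneg_def)
qed

lemma optimal_index_le:
  assumes "0 < \<epsilon>" and "\<mu> \<in> Meps_nonneg \<epsilon>"
  shows "optimal_index \<mu> \<le> ennreal \<epsilon>"
  unfolding optimal_index_def using assms by (intro Inf_lower) auto

lemma heat_solution_eq_top_iff:
  fixes x :: "'a::euclidean_space"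
  assumes "0 < t"
  shows "heat_solution \<mu> x t = \<infinity>
    \<longleftrightarrow> (\<integral>\<^sup>+ y. ennreal (exp (- (1 / (4 * t)) * (norm (x - y))\<^sup>2)) \<partial>\<mu>) = \<infinity>"
proof -
  have "0 < 1 / (4 * pi * t) powr (real DIM('a) / 2)"
    using assms by simp
  then show ?thesis
    unfolding heat_solution_def by (auto simp: ennreal_mult_eq_top_iff)
qed

lemma heat_solution_infinite_beyond_optimal_index:
  fixes x :: "'a::euclidean_space"
  assumes \<mu>: "\<mu> \<in> Mloc_nonneg" and t: "0 < t"
    and less: "ennreal (1 / (4 * t)) < optimal_index \<mu>"
  shows "heat_solution \<mu> x t = \<infinity>"
proof (rule ccontr)
  assume "heat_solution \<mu> x t \<noteq> \<infinity>"
  then have fin: "(\<integral>\<^sup>+ y. ennreal (exp (- (1 / (4 * t)) * (norm (x - y))\<^sup>2)) \<partial>\<mu>) < \<infinity>"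
    using heat_solution_eq_top_iff[OF t, of \<mu> x] by (simp add: less_top[symmetric])
  have pos: "0 < 1 / (4 * t)"
    using t by simp
  obtain e where e: "ennreal (1 / (4 * t)) < e" "e < optimal_index \<mu>"
    using dense[OF less] by blast
  then obtain \<delta> where \<delta>: "e = ennreal \<delta>" "0 \<le> \<delta>"
    by (cases e) (auto simp: top_unique)
  then have gt: "1 / (4 * t) < \<delta>"
    using e pos by (simp add: ennreal_less_iff)
  have "\<mu> \<in> Meps_nonneg \<delta>"
    by (rule Meps_nonneg_if_gaussian_integral_finite[OF \<mu> pos gt fin])
  moreover have "0 < \<delta>"
    using pos gt by linarith
  ultimately have "optimal_index \<mu> \<le> ennreal \<delta>"
    by (intro optimal_index_le)
  with e \<delta> show False
    by simp
qed

text \<open>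
  A limit in \<open>[0, \<infinity>]\<close>: it holds also where the value at \<open>T\<close> is infinite. It suffices to follow
  increasing sequences of times, for which the Gaussians increase and the monotone convergence
  theorem applies.
\<close>

lemma heat_solution_tendsto_at_left:
  fixes x :: "'a::euclidean_space"
  assumes \<mu>: "\<mu> \<in> Mloc_nonneg" and T: "0 < T"
  shows "((\<lambda>t. heat_solution \<mu> x t) \<longlongrightarrow> heat_solution \<mu> x T) (at_left T)"
proof (rule tendsto_at_left_sequentially[OF T])
  fix S :: "nat \<Rightarrow> real"
  assume S: "\<And>n. S n < T" "\<And>n. 0 < S n" "incseq S" "S \<longlonglongrightarrow> T"
  define g where "g t y = exp (- (norm (x - y))\<^sup>2 / (4 * t))" for t :: real and y :: 'a
  have mono: "g s y \<le> g t y" if "0 < s" "s \<le> t" for s t y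
    using that by (auto simp: g_def intro!: divide_left_mono)
  have int: "(\<lambda>n. \<integral>\<^sup>+ y. ennreal (g (S n) y) \<partial>\<mu>) \<longlonglongrightarrow> (\<integral>\<^sup>+ y. ennreal (g T y) \<partial>\<mu>)"
  proof (rule nn_integral_LIMSEQ)
    show "incseq (\<lambda>n y. ennreal (g (S n) y))"
      using S mono by (auto simp: incseq_def le_fun_def intro!: ennreal_leI)
    show "(\<lambda>y. ennreal (g (S n) y)) \<in> borel_measurable \<mu>" for n
      unfolding g_def by (intro Mloc_nonneg_measurable[OF \<mu>]) measurable
    show "(\<lambda>n. ennreal (g (S n) y)) \<longlonglongrightarrow> ennreal (g T y)" for y
      unfolding g_def using T S(4) by (intro tendsto_ennrealI tendsto_intros) auto
  qed
  have pre: "(\<lambda>n. ennreal (1 / (4 * pi * S n) powr (real DIM('a) / 2)))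
      \<longlonglongrightarrow> ennreal (1 / (4 * pi * T) powr (real DIM('a) / 2))"
    using T S(4) by (intro tendsto_ennrealI tendsto_intros) auto
  \<comment> \<open>Multiplication on \<open>[0, \<infinity>]\<close> is discontinuous only at \<open>0 \<cdot> \<infinity>\<close>; the limit prefactor is positive
    and finite.\<close>
  have "0 < 1 / (4 * pi * T) powr (real DIM('a) / 2)"
    using T by simp
  then show "(\<lambda>n. heat_solution \<mu> x (S n)) \<longlonglongrightarrow> heat_solution \<mu> x T"
    unfolding heat_solution_def using pre int unfolding g_def
    by (intro tendsto_mult_ennreal) auto
qed

lemma translate_in_Mloc_nonneg:
  fixes y :: "'a::euclidean_space"
  assumes \<mu>: "\<mu> \<in> Mloc_nonneg"
  shows "translate y \<mu> \<in> Mloc_nonneg"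
proof -
  have "emeasure (translate y \<mu>) K < \<infinity>" if K: "compact K" for K
  proof -
    have "(\<lambda>z. z + y) -` K = (\<lambda>z. - y + z) ` K"
      by (auto simp: image_iff algebra_simps intro!: bexI[where x = "_ + y"])
    moreover have "space \<mu> = UNIV"
      using \<mu> sets_eq_imp_space_eq[of \<mu> borel] by (simp add: Mloc_nonneg_def)
    moreover have "(\<lambda>z. z + y) \<in> borel_measurable \<mu>"
      by (intro Mloc_nonneg_measurable[OF \<mu>]) measurable
    ultimately have "emeasure (translate y \<mu>) K = emeasure \<mu> ((\<lambda>z. - y + z) ` K)"
      using K by (simp add: translate_def emeasure_distr borel_compact)
    also have "\<dots> < \<infinity>"
      using \<mu> compact_translation[OF K, of "- y"] by (simp add: Mloc_nonneg_def)
    finally show ?thesis .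
  qed
  then show ?thesis
    by (simp add: Mloc_nonneg_def translate_def)
qed

lemma translate_in_Meps_nonneg_iff:
  fixes x :: "'a::euclidean_space"
  assumes \<mu>: "\<mu> \<in> Mloc_nonneg"
  shows "translate (- x) \<mu> \<in> Meps_nonneg \<epsilon>
    \<longleftrightarrow> (\<integral>\<^sup>+ y. ennreal (exp (- \<epsilon> * (norm (x - y))\<^sup>2)) \<partial>\<mu>) < \<infinity>"
proof -
  have "(\<lambda>z. z + - x) \<in> borel_measurable \<mu>"
    by (intro Mloc_nonneg_measurable[OF \<mu>]) measurable
  then have "(\<integral>\<^sup>+ z. ennreal (exp (- \<epsilon> * (norm z)\<^sup>2)) \<partial>(translate (- x) \<mu>))
      = (\<integral>\<^sup>+ y. ennreal (exp (- \<epsilon> * (norm (y + - x))\<^sup>2)) \<partial>\<mu>)"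
    unfolding translate_def by (intro nn_integral_distr) auto
  then show ?thesis
    using translate_in_Mloc_nonneg[OF \<mu>] by (simp add: Meps_nonneg_def norm_minus_commute)
qed

theorem theorem5p5:
  fixes u0 :: "'a::euclidean_space measure" and \<epsilon>0 T :: real
  assumes "u0 \<in> Mloc_nonneg"
    and "0 < optimal_index u0" and "optimal_index u0 < \<infinity>"
    and "\<epsilon>0 = enn2real (optimal_index u0)"
    and "T = 1 / (4 * \<epsilon>0)"
  shows "(\<forall>x t. T < t \<longrightarrow> heat_solution u0 x t = \<infinity>) \<and>
    (\<forall>x. (translate (- x) u0 \<in> Meps_nonneg \<epsilon>0 \<longrightarrow>
            heat_solution u0 x T < \<infinity> \<and>
            ((\<lambda>t. heat_solution u0 x t) \<longlongrightarrow> heat_solution u0 x T) (at_left T)) \<and>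
         (translate (- x) u0 \<notin> Meps_nonneg \<epsilon>0 \<longrightarrow>
            ((\<lambda>t. heat_solution u0 x t) \<longlongrightarrow> \<infinity>) (at_left T)))"
proof -
  have \<epsilon>0: "0 < \<epsilon>0" and idx: "optimal_index u0 = ennreal \<epsilon>0"
    using assms(2-4) by (auto simp: enn2real_positive_iff less_top)
  have T: "0 < T" and inv: "1 / (4 * T) = \<epsilon>0"
    using \<epsilon>0 assms(5) by simp_all
  have beyond: "heat_solution u0 x t = \<infinity>" if "T < t" for x t
  proof (rule heat_solution_infinite_beyond_optimal_index[OF assms(1)])
    show "0 < t"
      using T that by simp
    have "1 / (4 * t) < 1 / (4 * T)"
      using T that by (simp add: frac_less2)
    then show "ennreal (1 / (4 * t)) < optimal_index u0"
      using \<epsilon>0 by (simp add: idx inv ennreal_lessI)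
  qed
  have finite_iff: "translate (- x) u0 \<in> Meps_nonneg \<epsilon>0 \<longleftrightarrow> heat_solution u0 x T < \<infinity>" for x
    using translate_in_Meps_nonneg_iff[OF assms(1), of x \<epsilon>0]
      heat_solution_eq_top_iff[OF T, of u0 x]
    unfolding inv by (simp add: less_top[symmetric])
  have lim: "((\<lambda>t. heat_solution u0 x t) \<longlongrightarrow> heat_solution u0 x T) (at_left T)" for x
    by (rule heat_solution_tendsto_at_left[OF assms(1) T])
  have "((\<lambda>t. heat_solution u0 x t) \<longlongrightarrow> \<infinity>) (at_left T)"
    if "translate (- x) u0 \<notin> Meps_nonneg \<epsilon>0" for x
  proof -
    have "heat_solution u0 x T = \<infinity>"
      using that finite_iff[of x] by (simp add: less_top[symmetric])
    then show ?thesis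
      using lim[of x] by simp
  qed
  then show ?thesis
    using beyond finite_iff lim by blast
qed

end
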